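(* For any integers $m$ and $d$ with $2\le d<m$, there exist $m$ pairwise distinct distributions $D^1,\dots,D^m$ of value profiles of some number of bidders, with a common finite support, each satisfying the Crémer–McLean condition, which span a $d$-dimensional linear space, such that for every integer $k$ with $0\le k\le m-d$, there is at least one bidder $i$ for which the vectors $\{F_i^{v_i,j}\}_{v_i\in T_i,\,j\in\{1,\dots,m\}}$ (formed with $k$ samples) are not linearly independent.
   Context: All distributions $D^j$ have the same finite support $T$; $T_i$ is the set of possible values $v_i$ of bidder $i$ and $T_{-i}$ the set of possible profiles $v_{-i}$ of the other bidders' values. Each $D^j$ is regarded as the vector $(D^j(v))_{v\in T}\in\mathbb R^{|T|}$ of its probabilities. For $v_i\in T_i$, $D^j_{i,v_i}\in\mathbb R^{|T_{-i}|}$ is the vector of conditional probabilities $(D^j(v_{-i}\mid v_i))_{v_{-i}}$. Crémer–McLean condition for $D$: for each bidder $i$, the $|T_i|$ vectors $\{D_{i,v_i}\}_{v_i\in T_i}$ are linearly independent. With $k$ samples, $F_i^{v_i,j}\in\mathbb R^{|T_{-i}|\times|T|^k}$ is the vector whose entry at $(v_{-i},s_1,\dots,s_k)$, $v_{-i}\in T_{-i}$, $s_1,\dots,s_k\in T$, is $D^j(v_{-i}\mid v_i)\,D^j(s_1)\cdots D^j(s_k)$, i.e. $F_i^{v_i,j}=D^j_{i,v_i}\otimes D^j\otimes\cdots\otimes D^j$ ($k$ Kronecker factors $D^j$). Linear independence refers to the family indexed by pairs $(v_i,j)$. *)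

theory Defs
  imports "HOL-Probability.Probability" "HOL-Library.Function_Algebras"
begin

text \<open>
  For a set \<open>X\<close>, the space $\mathbb R^X$ is represented by the real functions vanishing outside
  \<open>X\<close>, as a subspace of the space of all real functions with pointwise operations.
\<close>

global_interpretation fun_vs: vector_space "\<lambda>(c::real) (f::'b \<Rightarrow> real) x. c * f x"
  by unfold_locales (auto simp: fun_eq_iff algebra_simps)

definition vec_on :: "'b set \<Rightarrow> ('b \<Rightarrow> real) \<Rightarrow> 'b \<Rightarrow> real" where
  "vec_on X f = (\<lambda>x. if x \<in> X then f x else 0)"

text \<open>
  Linear independence of an indexed family. Since \<open>fun_vs.independent\<close> is about sets of vectors,
  injectivity is needed to exclude repeated members.
\<close>

definition indep_family :: "'a set \<Rightarrow> ('a \<Rightarrow> 'b \<Rightarrow> real) \<Rightarrow> bool" where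
  "indep_family I f \<longleftrightarrow> inj_on f I \<and> fun_vs.independent (f ` I)"

text \<open>
  The bidders are \<open>0, \<dots>, n - 1\<close>; a profile is a function that is \<open>undefined\<close> outside \<open>{..<n}\<close>,
  and a profile of the bidders other than \<open>i\<close> is \<open>undefined\<close> at \<open>i\<close> as well.
\<close>

type_synonym profile = "nat \<Rightarrow> real"

definition profiles :: "nat \<Rightarrow> profile set" where
  "profiles n = ({..<n} \<rightarrow>\<^sub>E UNIV)"

definition others :: "nat \<Rightarrow> nat \<Rightarrow> profile \<Rightarrow> profile" where
  "others n i v = restrict v ({..<n} - {i})"

definition values_of :: "profile set \<Rightarrow> nat \<Rightarrow> real set" where
  "values_of T i = (\<lambda>v. v i) ` T"

definition others_of :: "nat \<Rightarrow> profile set \<Rightarrow> nat \<Rightarrow> profile set" where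
  "others_of n T i = others n i ` T"

definition dist_vec :: "profile pmf \<Rightarrow> profile \<Rightarrow> real" where
  "dist_vec D = vec_on (set_pmf D) (pmf D)"

definition cond_vec :: "nat \<Rightarrow> profile pmf \<Rightarrow> nat \<Rightarrow> real \<Rightarrow> profile \<Rightarrow> real" where
  "cond_vec n D i x =
     vec_on (others_of n (set_pmf D) i)
       (\<lambda>w. \<P>(v in measure_pmf D. others n i v = w \<bar> v i = x))"

definition cremer_mclean :: "nat \<Rightarrow> profile pmf \<Rightarrow> bool" where
  "cremer_mclean n D \<longleftrightarrow>
     (\<forall>i<n. indep_family (values_of (set_pmf D) i) (cond_vec n D i))"

text \<open>The \<open>k\<close> samples \<open>s\<^sub>1, \<dots>, s\<^sub>k\<close> form a list of length \<open>k\<close>.\<close>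

definition sample_vec ::
    "nat \<Rightarrow> nat \<Rightarrow> profile pmf \<Rightarrow> nat \<Rightarrow> real \<Rightarrow> profile \<times> profile list \<Rightarrow> real" where
  "sample_vec n k D i x =
     vec_on (others_of n (set_pmf D) i \<times> {s. set s \<subseteq> set_pmf D \<and> length s = k})
       (\<lambda>(w, s). cond_vec n D i x w * (\<Prod>l<k. dist_vec D (s ! l)))"

end

theory Submission
  imports Defs
begin

text \<open>
  Take two bidders, both with values in \<open>X = {0, \<dots>, d - 1}\<close>, and let \<open>D\<^sup>j(x, y)\<close> be proportional to
  \<open>w\<^sub>j(x) (1 + [x = y])\<close> with \<open>w\<^sub>j > 0\<close>. The matrix \<open>1 + [x = y]\<close> is invertible, which gives the
  Cremer--McLean condition, and the conditional distribution of the second bidder's value given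
  the first one's does not depend on \<open>j\<close>. Choose \<open>w\<^sub>j = u + j e\<^sub>0\<close>, with \<open>u\<close> the all-one vector,
  for \<open>j \<le> s = m - d + 2\<close>, and use the remaining \<open>d - 2\<close> indices to add the
  directions \<open>e\<^sub>1, \<dots>, e\<^bsub>d-2\<^esub>\<close>. For \<open>j \<le> s\<close> the entries of the \<open>k\<close>-fold tensor power of \<open>D\<^sup>j\<close> are,
  up to a factor depending only on \<open>j\<close>, polynomials in \<open>j\<close> of degree at most
  \<open>k \<le> m - d = s - 2\<close>, so their finite difference of order \<open>s - 1\<close> vanishes; tensoring this
  relation with the common conditional vector gives the linear dependence.
\<close>

section \<open>Linear independence in terms of coefficients\<close>

lemma sum_fun_apply: "(\<Sum>i\<in>I. f i) z = (\<Sum>i\<in>I. f i z)"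
  for f :: "'a \<Rightarrow> 'b \<Rightarrow> 'c::comm_monoid_add"
  by (induction I rule: infinite_finite_induct) auto

text \<open>Coefficients are transported along \<open>f\<close> and its inverse on \<open>I\<close>.
  A repetition \<open>f a = f b\<close> would yield a nontrivial relation, the indicator of
  \<open>a\<close> minus that of \<open>b\<close>.\<close>

lemma indep_family_iff:
  fixes f :: "'a \<Rightarrow> 'b \<Rightarrow> real"
  assumes "finite I"
  shows "indep_family I f \<longleftrightarrow>
    (\<forall>c. (\<forall>z. (\<Sum>i\<in>I. c i * f i z) = 0) \<longrightarrow> (\<forall>i\<in>I. c i = 0))"
proof
  assume ind: "indep_family I f"
  then have inj: "inj_on f I" and li: "fun_vs.independent (f ` I)"
    by (auto simp: indep_family_def)
  show "\<forall>c. (\<forall>z. (\<Sum>i\<in>I. c i * f i z) = 0) \<longrightarrow> (\<forall>i\<in>I. c i = 0)"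
  proof (intro allI impI ballI)
    fix c i assume eq: "\<forall>z. (\<Sum>i\<in>I. c i * f i z) = 0" and i: "i \<in> I"
    have "(\<Sum>v\<in>f ` I. (\<lambda>z. c (inv_into I f v) * v z)) = (\<Sum>i\<in>I. (\<lambda>z. c i * f i z))"
      by (subst sum.reindex[OF inj]) (auto intro!: sum.cong simp: inj)
    also have "\<dots> = 0"
      using eq by (auto simp: fun_eq_iff sum_fun_apply)
    finally have "c (inv_into I f (f i)) = 0"
      using fun_vs.independentD[OF li, of "f ` I" "\<lambda>v. c (inv_into I f v)" "f i"] assms i by auto
    then show "c i = 0"
      using inj i by simp
  qed
next
  assume *: "\<forall>c. (\<forall>z. (\<Sum>i\<in>I. c i * f i z) = 0) \<longrightarrow> (\<forall>i\<in>I. c i = 0)"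
  have inj: "inj_on f I"
  proof (rule inj_onI, rule ccontr)
    fix a b assume ab: "a \<in> I" "b \<in> I" "f a = f b" "a \<noteq> b"
    let ?c = "\<lambda>i. (if i = a then 1 else 0) - (if i = b then 1 else 0 :: real)"
    have "\<forall>z. (\<Sum>i\<in>I. ?c i * f i z) = 0"
      using ab assms
      by (simp add: left_diff_distrib sum_subtractf if_distrib[of "\<lambda>x. x * _"] cong: if_cong)
    then have "?c a = 0" using *[rule_format, of ?c a] ab by simp
    then show False using ab by simp
  qed
  have "fun_vs.independent (f ` I)"
  proof (rule fun_vs.independent_if_scalars_zero)
    show "finite (f ` I)" using assms by simp
    fix g v assume eq: "(\<Sum>x\<in>f ` I. (\<lambda>z. g x * x z)) = 0" and v: "v \<in> f ` I"
    have "(\<Sum>i\<in>I. (\<lambda>z. g (f i) * f i z)) = 0"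
      using eq by (subst (asm) sum.reindex[OF inj]) simp
    then have "\<forall>z. (\<Sum>i\<in>I. g (f i) * f i z) = 0"
      by (auto simp: fun_eq_iff sum_fun_apply)
    then show "g v = 0" using *[rule_format, of "\<lambda>i. g (f i)"] v by auto
  qed
  with inj show "indep_family I f" by (simp add: indep_family_def)
qed

section \<open>Distributions with prescribed positive weights\<close>

lemma exists_pmf_proportional:
  fixes f :: "'a \<Rightarrow> real"
  assumes "finite T" "T \<noteq> {}" "\<And>v. v \<in> T \<Longrightarrow> 0 < f v"
  shows "\<exists>D. set_pmf D = T \<and> (\<forall>v\<in>T. pmf D v = f v / sum f T)"
proof -
  let ?g = "\<lambda>v. if v \<in> T then f v / sum f T else 0"
  have pos: "0 < sum f T" using assms by (simp add: sum_pos)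
  have nn: "0 \<le> ?g v" for v using assms(3)[of v] pos by (simp add: less_imp_le)
  have "(\<integral>\<^sup>+v. ennreal (?g v) \<partial>count_space UNIV) = (\<integral>\<^sup>+v. ennreal (?g v) \<partial>count_space T)"
    by (intro nn_integral_count_space_eq) auto
  also have "\<dots> = (\<Sum>v\<in>T. ennreal (?g v))"
    by (rule nn_integral_count_space_finite[OF assms(1)])
  also have "\<dots> = ennreal (\<Sum>v\<in>T. ?g v)"
    using nn by (intro sum_ennreal)
  also have "(\<Sum>v\<in>T. ?g v) = (\<Sum>v\<in>T. f v / sum f T)" by (rule sum.cong) auto
  also have "\<dots> = 1" using pos by (simp flip: sum_divide_distrib)
  finally have one: "(\<integral>\<^sup>+v. ennreal (?g v) \<partial>count_space UNIV) = 1" by simp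
  have "pmf (embed_pmf ?g) v = ?g v" for v by (rule pmf_embed_pmf[OF nn one])
  moreover have "set_pmf (embed_pmf ?g) = T"
    using set_embed_pmf[OF nn one] assms(3) pos by force
  ultimately show ?thesis by (intro exI[of _ "embed_pmf ?g"]) auto
qed

text \<open>A finite-difference identity: a product of fewer than \<open>N\<close> affine functions of \<open>j\<close>
  is a polynomial of degree less than \<open>N\<close>.\<close>

lemma alternating_binomial_sum_prod_affine:
  fixes a b :: "nat \<Rightarrow> real"
  assumes "k < N"
  shows "(\<Sum>j\<le>N. (-1) ^ j * real (N choose j) * (\<Prod>l<k. a l + real j * b l)) = 0"
  using assms
proof (induction k arbitrary: N a)
  case 0
  then show ?case using choose_alternating_sum[of N, where 'a = real] by simp
next
  case (Suc k)
  then obtain M where N: "N = Suc M" and M: "k < M" by (cases N) auto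
  let ?P = "\<lambda>j. \<Prod>l<k. a l + real j * b l"
  let ?h = "\<lambda>j. (-1) ^ j * real (N choose j) * ?P j"
  \<comment> \<open>Absorption \<open>(j + 1) * (N choose (j + 1)) = N * (M choose j)\<close> trades
    the factor \<open>j\<close> of the last affine function for a lower order; the index shift turns
    \<open>a\<close> into \<open>a + b\<close>.\<close>
  have absorb: "(-1) ^ Suc j * real (N choose Suc j) * ?P (Suc j) * real (Suc j) =
      - real N * ((-1) ^ j * real (M choose j) * (\<Prod>l<k. (a l + b l) + real j * b l))" for j
  proof -
    have "real (Suc j) * real (N choose Suc j) = real N * real (M choose j)"
      using Suc_times_binomial[of j M] unfolding N by (metis of_nat_mult)
    moreover have "?P (Suc j) = (\<Prod>l<k. (a l + b l) + real j * b l)"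
      by (rule prod.cong) (auto simp: algebra_simps)
    ultimately show ?thesis by (simp del: of_nat_Suc of_nat_mult add: mult_ac)
  qed
  have "(\<Sum>j\<le>N. ?h j * real j) =
      - real N * (\<Sum>j\<le>M. (-1) ^ j * real (M choose j) * (\<Prod>l<k. (a l + b l) + real j * b l))"
    unfolding N sum.atMost_Suc_shift sum_distrib_left
    by (simp only: absorb[unfolded N] of_nat_0 mult_zero_right add_0)
  also have "\<dots> = 0" using Suc.IH[OF M, of "\<lambda>l. a l + b l"] by simp
  finally have 1: "(\<Sum>j\<le>N. ?h j * real j) = 0" .
  have 2: "(\<Sum>j\<le>N. ?h j) = 0" using Suc.IH[of N a] Suc.prems by simp
  have "(\<Sum>j\<le>N. (-1) ^ j * real (N choose j) * (\<Prod>l<Suc k. a l + real j * b l)) =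
      a k * (\<Sum>j\<le>N. ?h j) + b k * (\<Sum>j\<le>N. ?h j * real j)"
    unfolding sum_distrib_left sum.distrib[symmetric]
    by (rule sum.cong) (auto simp: algebra_simps)
  then show ?case using 1 2 by simp
qed

section \<open>Profiles of two bidders\<close>

definition profile2 :: "nat \<Rightarrow> real \<Rightarrow> real \<Rightarrow> profile" where
  "profile2 i x y = (\<lambda>l. if l = i then x else if l < 2 then y else undefined)"

text \<open>Listing the own value of bidder \<open>i\<close> first lets one argument serve both
  bidders; this reduces bidder 1 to data stated for bidder 0.\<close>

lemma profile2_swap: "profile2 1 x y = profile2 0 y x"
  by (auto simp: profile2_def fun_eq_iff)

lemma PiE2_iff:
  assumes "i < 2"
  shows "v \<in> ({..<2} \<rightarrow>\<^sub>E X) \<longleftrightarrow> (\<exists>x\<in>X. \<exists>y\<in>X. v = profile2 i x y)"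
proof
  assume v: "v \<in> ({..<2} \<rightarrow>\<^sub>E X)"
  \<comment> \<open>Since \<open>i < 2\<close>, the other bidder is \<open>1 - i\<close>.\<close>
  have "v = profile2 i (v i) (v (1 - i))"
  proof
    fix l show "v l = profile2 i (v i) (v (1 - i)) l"
      using v assms by (cases "l < 2") (auto simp: profile2_def PiE_def extensional_def less_2_cases_iff)
  qed
  moreover have "v i \<in> X" "v (1 - i) \<in> X" using v assms by (auto simp: PiE_def Pi_def)
  ultimately show "\<exists>x\<in>X. \<exists>y\<in>X. v = profile2 i x y" by blast
qed (use assms in \<open>auto simp: profile2_def split: if_splits\<close>)

lemma others_profile2: "others 2 i (profile2 i x y) = others 2 i (profile2 i x' y)"
  by (auto simp: others_def profile2_def fun_eq_iff restrict_def)

lemma others_profile2_eq_iff: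
  assumes "i < 2"
  shows "others 2 i (profile2 i x y) = others 2 i (profile2 i x' y') \<longleftrightarrow> y = y'"
proof
  assume *: "others 2 i (profile2 i x y) = others 2 i (profile2 i x' y')"
  have "1 - i \<noteq> i" "1 - i < 2" using assms by presburger+
  then show "y = y'"
    using fun_cong[OF *, of "1 - i"] by (auto simp: others_def profile2_def)
qed (use others_profile2 in auto)

lemma values_of_PiE2:
  assumes "i < 2"
  shows "values_of ({..<2} \<rightarrow>\<^sub>E X) i = X"
proof -
  have "v i \<in> X" if "v \<in> ({..<2} \<rightarrow>\<^sub>E X)" for v :: profile
    using that assms by (auto simp: PiE_def)
  moreover have "x \<in> values_of ({..<2} \<rightarrow>\<^sub>E X) i" if "x \<in> X" for x
    unfolding values_of_def
    using that PiE2_iff[OF assms, of "profile2 i x x" X]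
    by (intro image_eqI[of _ _ "profile2 i x x"]) (auto simp: profile2_def)
  ultimately show ?thesis by (auto simp: values_of_def)
qed

text \<open>Both values together determine one profile of the support. The value \<open>x'\<close>
  is erased by \<open>others\<close>; leaving it free allows the same index to be used for every
  \<open>x\<close>.\<close>

lemma cond_vec_profile2:
  assumes "i < 2" and T: "set_pmf D = ({..<2} \<rightarrow>\<^sub>E X)" and "x \<in> X" "x' \<in> X" "y \<in> X"
  shows "cond_vec 2 D i x (others 2 i (profile2 i x' y)) =
    pmf D (profile2 i x y) / measure_pmf.prob D {v. v i = x}"
proof -
  let ?A = "{v. others 2 i v = others 2 i (profile2 i x' y) \<and> v i = x}"
  have in_T: "profile2 i x y \<in> set_pmf D" "profile2 i x' y \<in> set_pmf D"
    unfolding T PiE2_iff[OF assms(1)] using assms by auto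
  have "?A \<inter> set_pmf D = {profile2 i x y}"
  proof (intro equalityI subsetI)
    fix v assume "v \<in> ?A \<inter> set_pmf D"
    then obtain a b where v: "v = profile2 i a b" and *: "v \<in> ?A"
      unfolding T using PiE2_iff[OF assms(1)] by blast
    have "a = x" using * v by (auto simp: profile2_def)
    moreover have "b = y" using * v others_profile2_eq_iff[OF assms(1)] by auto
    ultimately show "v \<in> {profile2 i x y}" using v by simp
  next
    fix v assume "v \<in> {profile2 i x y}"
    then show "v \<in> ?A \<inter> set_pmf D"
      using in_T others_profile2[of i x y x'] by (auto simp: profile2_def)
  qed
  then have "measure_pmf.prob D ?A = pmf D (profile2 i x y)"
    using measure_Int_set_pmf[of D ?A] by (simp add: measure_pmf_single)
  moreover have "others 2 i (profile2 i x' y) \<in> others_of 2 (set_pmf D) i"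
    using in_T by (auto simp: others_of_def)
  ultimately show ?thesis
    by (simp add: cond_vec_def vec_on_def cond_prob_def)
qed

lemma prob_coordinate_pos:
  assumes "(i :: nat) < 2" "set_pmf D = ({..<2} \<rightarrow>\<^sub>E X)" "x \<in> X"
  shows "0 < measure_pmf.prob D {v. v i = (x :: real)}"
proof -
  have "profile2 i x x \<in> set_pmf D"
    unfolding assms(2) PiE2_iff[OF assms(1)] using assms(3) by auto
  then show ?thesis
    by (rule measure_pmf_posI) (auto simp: profile2_def)
qed

section \<open>The Cremer--McLean condition for weighted matrices\<close>

definition diag_weight :: "real \<Rightarrow> real \<Rightarrow> real" where
  "diag_weight x y = (if x = y then 2 else 1)"

lemma diag_weight_commute: "diag_weight x y = diag_weight y x"
  by (auto simp: diag_weight_def)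

text \<open>Each equation reads \<open>a y = - sum a X\<close>, so \<open>a\<close> is constant on
  \<open>X\<close>; summing over \<open>X\<close> gives
  \<open>(1 + card X) * sum a X = 0\<close>.\<close>

lemma diag_weight_kernel:
  assumes "finite X" and "\<And>y. y \<in> X \<Longrightarrow> (\<Sum>x\<in>X. a x * diag_weight x y) = 0" and "x \<in> X"
  shows "a x = 0"
proof -
  have *: "a y = - sum a X" if "y \<in> X" for y
  proof -
    have "(\<Sum>x\<in>X. a x * diag_weight x y) = (\<Sum>x\<in>X. a x + (if x = y then a x else 0))"
      by (rule sum.cong) (auto simp: diag_weight_def)
    also have "\<dots> = sum a X + a y" using that assms(1) by (simp add: sum.distrib)
    finally show ?thesis using assms(2)[OF that] by simp
  qed
  have "sum a X = (\<Sum>y\<in>X. - sum a X)" by (rule sum.cong[OF refl *])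
  then have "sum a X = real (card X) * - sum a X" by (simp only: sum_constant)
  then have "(1 + real (card X)) * sum a X = 0" by algebra
  moreover have "1 + real (card X) \<noteq> 0" by linarith
  ultimately have "sum a X = 0" by simp
  then show ?thesis using *[OF assms(3)] by simp
qed

text \<open>Conditioning and the weights only rescale rows and columns of the matrix
  \<open>diag_weight\<close> by positive factors, so its trivial kernel is inherited.\<close>

lemma cremer_mclean_product_weight:
  assumes X: "finite X" and T: "set_pmf D = ({..<2} \<rightarrow>\<^sub>E X)" and "Z > 0"
    and w: "\<And>x. x \<in> X \<Longrightarrow> w x > 0"
    and D: "\<And>x y. x \<in> X \<Longrightarrow> y \<in> X \<Longrightarrow> pmf D (profile2 0 x y) = w x * diag_weight x y / Z"
  shows "cremer_mclean 2 D"
  unfolding cremer_mclean_def T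
proof (intro allI impI)
  fix i :: nat assume i: "i < 2"
  let ?p = "\<lambda>x. measure_pmf.prob D {v. v i = x}"
  have p: "?p x > 0" if "x \<in> X" for x
    using prob_coordinate_pos[OF i T that] .
  \<comment> \<open>\<open>r\<close> is the factor of the own value and \<open>q\<close> that of the
    other value; symmetry of \<open>diag_weight\<close> covers bidder 1.\<close>
  define r where "r x = (if i = 0 then w x else 1)" for x
  define q where "q y = (if i = 0 then 1 else w y)" for y
  have r: "r x > 0" if "x \<in> X" for x using w[OF that] by (simp add: r_def)
  have q: "q x > 0" if "x \<in> X" for x using w[OF that] by (simp add: q_def)
  have D': "pmf D (profile2 i x y) = r x * q y * diag_weight x y / Z" if "x \<in> X" "y \<in> X" for x y
  proof (cases "i = 0")
    case False
    then have "i = 1" using i by simp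
    then show ?thesis
      using D[of y x] that by (simp add: profile2_swap[simplified] r_def q_def diag_weight_commute)
  qed (use D that in \<open>simp add: r_def q_def\<close>)
  show "indep_family (values_of ({..<2} \<rightarrow>\<^sub>E X) i) (cond_vec 2 D i)"
    unfolding values_of_PiE2[OF i] indep_family_iff[OF X]
  proof (intro allI impI ballI)
    fix c x assume eq: "\<forall>z. (\<Sum>x\<in>X. c x * cond_vec 2 D i x z) = 0" and x: "x \<in> X"
    have "(\<Sum>x\<in>X. (c x * r x / ?p x) * diag_weight x y) = 0" if y: "y \<in> X" for y
    proof -
      have "0 = (\<Sum>x\<in>X. c x * cond_vec 2 D i x (others 2 i (profile2 i y y)))"
        using eq by simp
      also have "\<dots> = (\<Sum>x\<in>X. q y / Z * ((c x * r x / ?p x) * diag_weight x y))"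
        by (rule sum.cong) (simp_all add: cond_vec_profile2[OF i T] D' y)
      finally show ?thesis
        using q[OF y] \<open>Z > 0\<close> by (simp only: sum_distrib_left[symmetric]) simp
    qed
    from diag_weight_kernel[OF X this x] have "c x * r x / ?p x = 0" by simp
    then show "c x = 0" using r[OF x] p[OF x] by simp
  qed
qed

text \<open>Mutual containment makes the two spans equal, so \<open>b\<close> is a basis of the span
  of \<open>S\<close>.\<close>

lemma dim_span_eq_card:
  assumes "finite I" "indep_family I b" "S \<subseteq> fun_vs.span (b ` I)" "b ` I \<subseteq> fun_vs.span S"
  shows "fun_vs.dim (fun_vs.span S) = card I"
proof -
  have "fun_vs.span (b ` I) = fun_vs.span S"
    using assms by (simp add: fun_vs.span_eq)
  then have "fun_vs.dim (fun_vs.span S) = card (b ` I)"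
    using assms fun_vs.dim_eq_card[of "b ` I" "fun_vs.span S"]
    by (simp add: indep_family_def fun_vs.span_span)
  then show ?thesis
    using assms by (simp add: indep_family_def card_image)
qed

theorem proposition3:
  fixes m d :: nat
  assumes "2 \<le> d" and "d < m"
  shows "\<exists>(n :: nat) (T :: profile set) (D :: nat \<Rightarrow> profile pmf).
           finite T \<and> T \<subseteq> profiles n \<and>
           inj_on D {1..m} \<and>
           (\<forall>j\<in>{1..m}. set_pmf (D j) = T \<and> cremer_mclean n (D j)) \<and>
           fun_vs.dim (fun_vs.span ((\<lambda>j. dist_vec (D j)) ` {1..m})) = d \<and>
           (\<forall>k\<le>m - d. \<exists>i<n.
              \<not> indep_family (values_of T i \<times> {1..m})
                  (\<lambda>(x, j). sample_vec n k (D j) i x))"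
proof -

  \<comment> \<open>The weights and the distributions\<close>
  obtain e where e: "d = Suc e" using assms by (cases d) auto
  define X where "X = real ` {..<d}"
  define T :: "profile set" where "T = ({..<2} \<rightarrow>\<^sub>E X)"
  define s where "s = m - d + 2"
  text \<open>By truncated subtraction, \<open>pos j = 0\<close> for all \<open>j \<le> s\<close>: the first \<open>s\<close> distributions
    lie in a common plane.\<close>
  define pos where "pos j = real (j - s)" for j
  \<comment> \<open>The bump has height \<open>j\<close>, not 1: this separates indices sharing a
    position and makes the weights affine in \<open>j\<close>.\<close>
  define w where "w j x = (if x = pos j then 1 + real j else 1)" for j x
  define W where "W j v = w j (v 0) * diag_weight (v 0) (v 1)" for j and v :: profile
  define Z where "Z j = sum (W j) T" for j
  have finX: "finite X" and cardX: "card X = d"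
    by (auto simp: X_def card_image)
  have finT: "finite T" unfolding T_def by (intro finite_PiE finX) auto
  have X0: "0 \<in> X" and Xlast: "real e \<in> X" by (auto simp: X_def e)
  \<comment> \<open>For \<open>j \<le> m\<close>, \<open>j - s\<close> is at most
    \<open>d - 2 = e - 1\<close>, so the last value \<open>e\<close> never carries a bump.\<close>
  have posX: "pos j \<in> X" and pos_neq: "pos j \<noteq> real e" if "j \<in> {1..m}" for j
    using that assms by (auto simp: X_def pos_def s_def e)
  have T_iff: "v \<in> T \<longleftrightarrow> (\<exists>x\<in>X. \<exists>y\<in>X. v = profile2 0 x y)" for v
    unfolding T_def by (rule PiE2_iff) simp
  have w_pos: "w j x > 0" for j x by (auto simp: w_def)
  have diag_pos: "diag_weight x y > 0" for x y by (simp add: diag_weight_def)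
  have W_pos: "W j v > 0" for j v using w_pos diag_pos by (simp add: W_def)
  have T_ne: "T \<noteq> {}" using T_iff X0 by auto
  have Z_pos: "Z j > 0" for j
    unfolding Z_def using finT T_ne W_pos by (intro sum_pos)
  have "\<forall>j. \<exists>D. set_pmf D = T \<and> (\<forall>v\<in>T. pmf D v = W j v / Z j)"
    unfolding Z_def by (intro allI exists_pmf_proportional finT T_ne W_pos)
  then obtain D where D: "\<And>j. set_pmf (D j) = T" "\<And>j v. v \<in> T \<Longrightarrow> pmf (D j) v = W j v / Z j"
    by metis
  have W_profile2: "W j (profile2 0 x y) = w j x * diag_weight x y" for j x y
    by (simp add: W_def profile2_def)
  have pmf_D: "pmf (D j) (profile2 0 x y) = w j x * diag_weight x y / Z j"
    if "x \<in> X" "y \<in> X" for j x y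
    using D(2)[of "profile2 0 x y" j] that T_iff W_profile2 by auto
  have CM: "cremer_mclean 2 (D j)" for j
    by (rule cremer_mclean_product_weight[OF finX D(1)[unfolded T_def] Z_pos w_pos pmf_D])

  \<comment> \<open>Pairwise distinctness\<close>
  have inj: "inj_on D {1..m}"
  proof (rule inj_onI)
    fix i j assume ij: "i \<in> {1..m}" "j \<in> {1..m}" "D i = D j"
    \<comment> \<open>At the bump-free value \<open>e\<close> all weights are 1, so equal
      distributions have equal normalising constants.\<close>
    have w_last: "w l (real e) = 1" if "l \<in> {1..m}" for l
      using pos_neq[OF that] by (simp add: w_def)
    have eq: "w i x / Z i = w j x / Z j" if "x \<in> X" for x
    proof -
      have "w i x * diag_weight x x / Z i = w j x * diag_weight x x / Z j"
        using pmf_D[OF that that, of i] pmf_D[OF that that, of j] ij(3) by simp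
      then show ?thesis using diag_pos[of x x] Z_pos[of i] Z_pos[of j] by (simp add: field_simps)
    qed
    from eq[OF Xlast] have "Z i = Z j" using w_last ij by simp
    then have "w i (pos i) = w j (pos i)"
      using eq[OF posX[OF ij(1)]] Z_pos[of j] by simp
    \<comment> \<open>Here \<open>w i (pos i) = 1 + i > 1\<close>, so \<open>w j\<close> must have
      its bump at the same position and with the same height.\<close>
    then show "i = j" using ij by (auto simp: w_def split: if_splits)
  qed

  \<comment> \<open>Dimension of the span\<close>
  have dim: "fun_vs.dim (fun_vs.span ((\<lambda>j. dist_vec (D j)) ` {1..m})) = d"
  proof -
    \<comment> \<open>\<open>b x\<close> is the unnormalised density of the unit weight at
      \<open>x\<close>, \<open>u\<close> that of the all-one weight, and \<open>g j\<close> that of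
      \<open>w j\<close>.\<close>
    define b where "b x = vec_on T (\<lambda>v. if v 0 = x then diag_weight x (v 1) else 0)" for x
    define u where "u = (\<Sum>x\<in>X. b x)"
    define S where "S = (\<lambda>j. dist_vec (D j)) ` {1..m}"
    define g where "g j = u + (\<lambda>v. real j * b (pos j) v)" for j
    have u_eq: "u v = (if v \<in> T then diag_weight (v 0) (v 1) else 0)" for v
    proof (cases "v \<in> T")
      case True
      then have "v 0 \<in> X" unfolding T_def by (rule PiE_mem) simp
      have "u v = (\<Sum>x\<in>X. if v 0 = x then diag_weight x (v 1) else 0)"
        using True by (simp add: u_def sum_fun_apply b_def vec_on_def)
      also have "\<dots> = diag_weight (v 0) (v 1)" using \<open>v 0 \<in> X\<close> finX by simp
      finally show ?thesis using True by simp
    qed (simp add: u_def sum_fun_apply b_def vec_on_def)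
    have dist: "dist_vec (D j) = (\<lambda>v. (1 / Z j) * g j v)" for j
      by (auto simp: fun_eq_iff dist_vec_def D vec_on_def g_def u_eq b_def W_def w_def
          field_simps)
    have g: "g j \<in> fun_vs.span S" if "j \<in> {1..m}" for j
    proof -
      have "(\<lambda>v. Z j * dist_vec (D j) v) \<in> fun_vs.span S"
        using that by (intro fun_vs.span_scale fun_vs.span_base) (auto simp: S_def)
      then show ?thesis using Z_pos[of j] by (simp add: dist)
    qed
    \<comment> \<open>Indices 1 and 2 both have their bump at 0, so their difference isolates
      \<open>b 0\<close>, and then \<open>u\<close>.\<close>
    have g12: "g 1 = u + b 0" "g 2 = u + (\<lambda>v. 2 * b 0 v)"
      by (auto simp: g_def pos_def s_def)
    have "b 0 = g 2 - g 1" unfolding g12 by (simp add: fun_eq_iff)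
    then have b0: "b 0 \<in> fun_vs.span S"
      using g[of 1] g[of 2] assms by (simp add: fun_vs.span_diff)
    have "u = g 1 - b 0" unfolding g12 by simp
    then have u: "u \<in> fun_vs.span S"
      using g[of 1] b0 assms by (simp add: fun_vs.span_diff)
    have b_mid: "b (real l) \<in> fun_vs.span S" if "l < e" for l
    proof (cases "l = 0")
      case False
      \<comment> \<open>Index \<open>s + l\<close> is the one whose bump sits at
        \<open>l\<close>.\<close>
      have "b (real l) = (\<lambda>v. (1 / real (s + l)) * (g (s + l) - u) v)"
        using False by (auto simp: g_def pos_def fun_eq_iff)
      moreover have "s + l \<in> {1..m}" using that assms by (auto simp: s_def e)
      ultimately show ?thesis
        using g[of "s + l"] u by (simp only: fun_vs.span_scale fun_vs.span_diff)
    qed (use b0 in simp)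
    \<comment> \<open>No index has a bump at \<open>e\<close>; \<open>b (real e)\<close> is what
      remains of \<open>u\<close> after removing the other directions.\<close>
    have "u = (\<Sum>l<d. b (real l))"
      unfolding u_def X_def by (subst sum.reindex) auto
    also have "\<dots> = (\<Sum>l<e. b (real l)) + b (real e)"
      by (simp add: e)
    finally have "b (real e) = u - (\<Sum>l<e. b (real l))" by simp
    then have b_last: "b (real e) \<in> fun_vs.span S"
      using u b_mid by (auto intro!: fun_vs.span_diff fun_vs.span_sum)
    have b_span: "b ` X \<subseteq> fun_vs.span S"
    proof
      fix z assume "z \<in> b ` X"
      then obtain l where "l < d" "z = b (real l)" by (auto simp: X_def)
      then show "z \<in> fun_vs.span S"
        using b_mid[of l] b_last by (cases "l = e") (auto simp: e)
    qed
    have S_span: "S \<subseteq> fun_vs.span (b ` X)"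
    proof
      fix z assume "z \<in> S"
      then obtain j where j: "j \<in> {1..m}" "z = dist_vec (D j)" by (auto simp: S_def)
      show "z \<in> fun_vs.span (b ` X)"
        unfolding j(2) dist g_def u_def using posX[OF j(1)]
        by (intro fun_vs.span_scale fun_vs.span_add fun_vs.span_sum fun_vs.span_base) auto
    qed
    have "indep_family X b"
      unfolding indep_family_iff[OF finX]
    proof (intro allI impI ballI)
      fix c x assume eq: "\<forall>z. (\<Sum>x\<in>X. c x * b x z) = 0" and x: "x \<in> X"
      \<comment> \<open>The \<open>b y\<close> have disjoint supports; at the diagonal profile of
        \<open>x\<close> only \<open>b x\<close> survives.\<close>
      have "profile2 0 x x \<in> T" using T_iff x by auto
      then have "(\<Sum>y\<in>X. c y * b y (profile2 0 x x)) = (\<Sum>y\<in>X. if x = y then 2 * c y else 0)"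
        by (intro sum.cong) (auto simp: b_def vec_on_def profile2_def diag_weight_def)
      then show "c x = 0" using eq x finX by simp
    qed
    from dim_span_eq_card[OF finX this S_span b_span] show ?thesis
      by (simp add: cardX S_def)
  qed

  \<comment> \<open>Dependence of the sample vectors of bidder 0\<close>
  have dep: "\<not> indep_family (values_of T 0 \<times> {1..m}) (\<lambda>(x, j). sample_vec 2 k (D j) 0 x)"
    if k: "k \<le> m - d" for k
  proof
    define N where "N = m - d + 1"
    have kN: "k < N" and sN: "s = Suc N" and sm: "s \<le> m"
      using k assms by (auto simp: N_def s_def)
    define P where "P j = measure_pmf.prob (D j) {v. v 0 = 0}" for j
    have P_pos: "P j > 0" for j
      unfolding P_def using prob_coordinate_pos[of 0 "D j" X 0] D(1) X0 by (simp add: T_def)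
    have w_first: "w (Suc j) x = 1 + (if x = 0 then 1 + real j else 0)" if "j \<le> N" for j x
      using that by (simp add: w_def pos_def sN)
    \<comment> \<open>The last factor cancels all normalisation: \<open>k\<close> powers of
      \<open>Z\<close> from the samples, and one \<open>Z\<close>, \<open>P\<close> and
      \<open>w\<close> from the conditional vector. The index is shifted so that \<open>0..N\<close>
      stands for \<open>1..s\<close>.\<close>
    define C where "C j = (-1) ^ j * real (N choose j) * (Z (Suc j) ^ Suc k * P (Suc j) / w (Suc j) 0)" for j
    define c where "c = (\<lambda>(x, j). if x = (0 :: real) \<and> j \<le> s then C (j - 1) else 0)"
    assume "indep_family (values_of T 0 \<times> {1..m}) (\<lambda>(x, j). sample_vec 2 k (D j) 0 x)"
    then have ind: "indep_family (X \<times> {1..m}) (\<lambda>(x, j). sample_vec 2 k (D j) 0 x)"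
      using values_of_PiE2[of 0 X] by (simp add: T_def)
    have "(\<Sum>p\<in>X \<times> {1..m}. c p * (case p of (x, j) \<Rightarrow> sample_vec 2 k (D j) 0 x) z) = 0" for z
    proof -
      have "(\<Sum>p\<in>X \<times> {1..m}. c p * (case p of (x, j) \<Rightarrow> sample_vec 2 k (D j) 0 x) z) =
          (\<Sum>p\<in>{0} \<times> {1..s}. c p * (case p of (x, j) \<Rightarrow> sample_vec 2 k (D j) 0 x) z)"
        using finX X0 sm by (intro sum.mono_neutral_right) (auto simp: c_def split: if_splits)
      also have "\<dots> = (\<Sum>j\<in>{1..s}. C (j - 1) * sample_vec 2 k (D j) 0 0 z)"
        unfolding sum.cartesian_product' by (simp add: c_def)
      also have "\<dots> = (\<Sum>j\<le>N. C j * sample_vec 2 k (D (Suc j)) 0 0 z)"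
        by (rule sum.reindex_bij_witness[of _ Suc "\<lambda>j. j - 1"]) (auto simp: sN)
      also have "\<dots> = 0"
      proof (cases "z \<in> others_of 2 T 0 \<times> {ls. set ls \<subseteq> T \<and> length ls = k}")
        case True
        then obtain q ls where z: "z = (q, ls)" "q \<in> others_of 2 T 0" "set ls \<subseteq> T" "length ls = k"
          by auto
        then obtain x y where q: "q = others 2 0 (profile2 0 x y)" "x \<in> X" "y \<in> X"
          using T_iff by (auto simp: others_of_def)
        \<comment> \<open>Up to \<open>Z\<close>, the mass of sample \<open>l\<close> is affine in
          the shifted index: at own value 0 the weight is \<open>2 + j\<close>, elsewhere 1.\<close>
        define \<kappa> where "\<kappa> l = diag_weight ((ls ! l) 0) ((ls ! l) 1)" for l
        define \<alpha> where "\<alpha> l = \<kappa> l * (if (ls ! l) 0 = 0 then 2 else 1)" for l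
        define \<beta> where "\<beta> l = \<kappa> l * (if (ls ! l) 0 = 0 then 1 else 0)" for l
        have summand: "C j * sample_vec 2 k (D (Suc j)) 0 0 z =
            diag_weight 0 y * ((-1) ^ j * real (N choose j) * (\<Prod>l<k. \<alpha> l + real j * \<beta> l))"
          if "j \<le> N" for j
        proof -
          have "dist_vec (D (Suc j)) (ls ! l) = (\<alpha> l + real j * \<beta> l) / Z (Suc j)" if "l < k" for l
          proof -
            have "ls ! l \<in> T" using z that by auto
            then show ?thesis
              by (simp add: dist_vec_def vec_on_def D W_def w_first[OF \<open>j \<le> N\<close>] \<alpha>_def \<beta>_def \<kappa>_def
                  algebra_simps)
          qed
          then have "(\<Prod>l<k. dist_vec (D (Suc j)) (ls ! l)) =
              (\<Prod>l<k. \<alpha> l + real j * \<beta> l) / Z (Suc j) ^ k"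
            by (simp add: prod_dividef)
          moreover have "cond_vec 2 (D (Suc j)) 0 0 q =
              w (Suc j) 0 * diag_weight 0 y / Z (Suc j) / P (Suc j)"
            unfolding q P_def
            using cond_vec_profile2[of 0 "D (Suc j)" X 0 x y] D(1) X0 q pmf_D
            by (simp add: T_def)
          ultimately have "sample_vec 2 k (D (Suc j)) 0 0 z =
              w (Suc j) 0 * diag_weight 0 y / Z (Suc j) / P (Suc j) *
                ((\<Prod>l<k. \<alpha> l + real j * \<beta> l) / Z (Suc j) ^ k)"
            using z by (simp add: sample_vec_def vec_on_def D)
          then show ?thesis
            using Z_pos[of "Suc j"] P_pos[of "Suc j"] w_pos[of "Suc j" 0]
            by (simp add: C_def)
        qed
        have "(\<Sum>j\<le>N. C j * sample_vec 2 k (D (Suc j)) 0 0 z) = diag_weight 0 y *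
            (\<Sum>j\<le>N. (-1) ^ j * real (N choose j) * (\<Prod>l<k. \<alpha> l + real j * \<beta> l))"
          unfolding sum_distrib_left by (rule sum.cong) (simp_all add: summand)
        then show ?thesis
          using alternating_binomial_sum_prod_affine[OF kN, of \<alpha> \<beta>] by simp
      next
        case False
        then show ?thesis
          by (intro sum.neutral) (auto simp: sample_vec_def vec_on_def D)
      qed
      finally show ?thesis .
    qed
    \<comment> \<open>The coefficient at \<open>(0, 1)\<close> is \<open>C 0\<close>, whose binomial
      factor is 1, hence it is positive and the relation is nontrivial.\<close>
    moreover have "(0, 1) \<in> X \<times> {1..m}" using X0 assms by auto
    ultimately have "c (0, 1) = 0"
      using ind[unfolded indep_family_iff[OF finite_cartesian_product[OF finX finite_atLeastAtMost]]]
      by blast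
    then show False
      using Z_pos[of 1] P_pos[of 1] w_pos[of 1 0] by (simp add: c_def C_def sN)
  qed

  show ?thesis
  proof (intro exI conjI)
    show "finite T" by (rule finT)
    show "T \<subseteq> profiles 2" unfolding T_def profiles_def by (intro PiE_mono) simp
    show "inj_on D {1..m}" by (rule inj)
    show "\<forall>j\<in>{1..m}. set_pmf (D j) = T \<and> cremer_mclean 2 (D j)" using D CM by simp
    show "fun_vs.dim (fun_vs.span ((\<lambda>j. dist_vec (D j)) ` {1..m})) = d" by (rule dim)
    show "\<forall>k\<le>m - d. \<exists>i<2. \<not> indep_family (values_of T i \<times> {1..m})
        (\<lambda>(x, j). sample_vec 2 k (D j) i x)"
      using dep by (intro allI impI exI[of _ 0]) simp
  qed
qed

end
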